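(* Let $\{w_t\},\{u_{t,k}\},\{g_{t,k}\}$ be generated by memory-based distributed SGD with momentum $\beta\in[0,1)$ and learning rates $\{\eta_t\}$ (M-DSGD, described in the context), and put $\tilde u_t=\sum_{k=1}^p u_{t,k}$, $\tilde g_t=\sum_{k=1}^p g_{t,k}$, so that $\tilde g_t=\nabla f(w_t;\mathcal{I}_t)+\beta\tilde g_{t-1}$. Let $z_t=w_t+\rho_{t-1}\tilde g_{t-1}-\eta_t\tilde u_t$, where $\beta\rho_t=\beta\eta_t+\rho_{t-1}$. Assume $F$ is convex with $G$-bounded stochastic gradient, and $\mathbb{E}\|\tilde u_t\|^2\le U^2$, $\mathbb{E}\|z_t-w^*\|^2\le B^2$ for all $t$. By setting $$\rho_t=-\frac{\beta}{\sqrt{t+2}},\qquad \eta_t=\frac{1}{\sqrt{t+1}}\left(1-\frac{\beta\sqrt{t+1}}{\sqrt{t+2}}\right),$$ we have $$\sum_{t=0}^{T-1}\frac{2}{\sqrt{t+1}}\,\mathbb{E}\big(F(w_t)-F(w^* )\big)\le\|w_0-w^*\|^2+\sum_{t=0}^{T-1}\frac{C}{t+1},$$ where $C=2G\sqrt{2G^2\beta^2/(1-\beta)^2+2U^2}+2UB+2G^2+2U^2$. This implies an $\mathcal{O}(\log(T)/\sqrt T)$ convergence rate, i.e. the average of $\mathbb{E}(F(w_t)-F(w^* ))$, $0\le t\le T-1$, with weights proportional to $1/\sqrt{t+1}$ is $\mathcal{O}(\log(T)/\sqrt T)$ as $T\to\infty$.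
   Context: $\|\cdot\|$ is the Euclidean norm. The objective is $F(w)=\frac1n\sum_{i=1}^n f(w;\zeta_i)$, $w\in\mathbb{R}^d$, where $\zeta_1,\dots,\zeta_n$ are the training data, and $w^*$ is a minimizer of $F$. M-DSGD with momentum: there are $p$ workers, an initial point $w_0$, a momentum scalar $\beta\in[0,1)$, batch size $b$ and learning rates $\eta_t$. Set $g_{-1,k}=u_{0,k}=0$ for $k=1,\dots,p$. At iterations $t=0,1,2,\dots$ each worker $k$ randomly picks a mini-batch $\mathcal{I}_{t,k}$ of $b$ training samples and a vector $m_{t,k}\in\{0,1\}^d$, and with $\odot$ the coordinatewise product and $\mathbf 1=(1,\dots,1)^T$, $$g_{t,k}=\beta g_{t-1,k}+\frac{1}{pb}\sum_{\zeta_i\in\mathcal{I}_{t,k}}\nabla f(w_t;\zeta_i),\quad u_{t+1,k}=(\mathbf 1-m_{t,k})\odot(g_{t,k}+u_{t,k}),\quad w_{t+1}=w_t-\eta_t\sum_{k=1}^p m_{t,k}\odot(g_{t,k}+u_{t,k}).$$ The aggregated mini-batch gradient $\nabla f(w_t;\mathcal{I}_t)=\frac{1}{pb}\sum_{k=1}^p\sum_{\zeta_i\in\mathcal{I}_{t,k}}\nabla f(w_t;\zeta_i)$ satisfies $\mathbb{E}[\nabla f(w_t;\mathcal{I}_t)\mid w_t]=\nabla F(w_t)$. Throughout, $\mathbb{E}_{\zeta_i}\|\nabla f(w;\zeta_i)\|^2\le G^2$ for all $w$. $F$ has $G$-bounded stochastic gradient ($G>0$) means that the stochastic gradient $g=\nabla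 f(w;\mathcal{I}_t)$ satisfies $\mathbb{E}[g\mid w]=\nabla F(w)$ and $\mathbb{E}\|g\|^2\le G^2$ for all $w$. Convexity of $F$ means $F(w)\ge F(w')+\nabla F(w')^T(w-w')$ for all $w,w'$. *)

theory Defs
  imports "HOL-Probability.Probability" "HOL-Library.Landau_Symbols" "HOL-Library.Multiset"
begin

definition gradient :: "('a::real_inner \<Rightarrow> real) \<Rightarrow> 'a \<Rightarrow> 'a" where
  "gradient h x = (THE D. GDERIV h x :> D)"

lemma gradient_eq: "GDERIV h x :> D \<Longrightarrow> gradient h x = D"
  unfolding gradient_def
proof (rule the_equality)
  fix D' assume "GDERIV h x :> D" "GDERIV h x :> D'"
  then have "(\<lambda>y. inner y D') = (\<lambda>y. inner y D)"
    unfolding gderiv_def by (rule has_derivative_unique[rotated])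
  then have "inner (D' - D) (D' - D) = 0"
    by (metis inner_diff_right right_minus_eq)
  then show "D' = D" by simp
qed

definition objective :: "('v \<Rightarrow> 'z \<Rightarrow> real) \<Rightarrow> (nat \<Rightarrow> 'z) \<Rightarrow> nat \<Rightarrow> 'v \<Rightarrow> real" where
  "objective f \<zeta> n v = (1 / real n) * (\<Sum>i=1..n. f v (\<zeta> i))"

definition sample_gradient :: "('v::real_inner \<Rightarrow> 'z \<Rightarrow> real) \<Rightarrow> (nat \<Rightarrow> 'z) \<Rightarrow> nat \<Rightarrow> 'v \<Rightarrow> 'v" where
  "sample_gradient f \<zeta> i v = gradient (\<lambda>v'. f v' (\<zeta> i)) v"

(* A mini-batch is a multiset of sample indices, so that sampling with and without
   replacement are both covered. *)
definition minibatch_gradient ::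
  "('v::real_inner \<Rightarrow> 'z \<Rightarrow> real) \<Rightarrow> (nat \<Rightarrow> 'z) \<Rightarrow> nat \<Rightarrow> nat \<Rightarrow> (nat \<Rightarrow> nat multiset) \<Rightarrow> 'v \<Rightarrow> 'v" where
  "minibatch_gradient f \<zeta> p b Ib v =
     (1 / (real p * real b)) *\<^sub>R (\<Sum>k=1..p. \<Sum>i\<in>#Ib k. sample_gradient f \<zeta> i v)"

(* The iterations are numbered from 0, with g indexed by int because of the initial value
   at -1; in the updates of u and w the product of vectors is the coordinatewise one. The masks
   and mini-batches are arbitrary random variables: the masks may depend on the whole past and
   on the current mini-batches. *)
definition M_DSGD ::
  "'s measure \<Rightarrow> (real ^ 'd \<Rightarrow> 'z \<Rightarrow> real) \<Rightarrow> (nat \<Rightarrow> 'z) \<Rightarrow> nat \<Rightarrow> nat \<Rightarrow> nat \<Rightarrow> real \<Rightarrow> (nat \<Rightarrow> real) \<Rightarrow>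
   real ^ 'd \<Rightarrow> (nat \<Rightarrow> nat \<Rightarrow> 's \<Rightarrow> nat multiset) \<Rightarrow> (nat \<Rightarrow> nat \<Rightarrow> 's \<Rightarrow> real ^ 'd) \<Rightarrow>
   (int \<Rightarrow> nat \<Rightarrow> 's \<Rightarrow> real ^ 'd) \<Rightarrow> (nat \<Rightarrow> nat \<Rightarrow> 's \<Rightarrow> real ^ 'd) \<Rightarrow> (nat \<Rightarrow> 's \<Rightarrow> real ^ 'd) \<Rightarrow> bool" where
  "M_DSGD M f \<zeta> n p b \<beta> \<eta> w0 I m g u w \<longleftrightarrow>
     (\<forall>t. \<forall>k\<in>{1..p}. I t k \<in> measurable M (count_space UNIV) \<and>
        (\<forall>\<omega>\<in>space M. size (I t k \<omega>) = b \<and> set_mset (I t k \<omega>) \<subseteq> {1..n})) \<and>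
     (\<forall>t. \<forall>k\<in>{1..p}. m t k \<in> borel_measurable M \<and>
        (\<forall>\<omega>\<in>space M. \<forall>j. m t k \<omega> $ j \<in> {0, 1})) \<and>
     (\<forall>\<omega>\<in>space M.
        w 0 \<omega> = w0 \<and>
        (\<forall>k\<in>{1..p}. g (-1) k \<omega> = 0 \<and> u 0 k \<omega> = 0) \<and>
        (\<forall>t. (\<forall>k\<in>{1..p}.
                g (int t) k \<omega> = \<beta> *\<^sub>R g (int t - 1) k \<omega>
                  + (1 / (real p * real b)) *\<^sub>R (\<Sum>i\<in>#I t k \<omega>. sample_gradient f \<zeta> i (w t \<omega>)) \<and>
                u (Suc t) k \<omega> = (1 - m t k \<omega>) * (g (int t) k \<omega> + u t k \<omega>)) \<and>
             w (Suc t) \<omega> = w t \<omega> - \<eta> t *\<^sub>R (\<Sum>k=1..p. m t k \<omega> * (g (int t) k \<omega> + u t k \<omega>))))"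

(* Conditional expectation of the random vector X given the sigma-algebra generated by Y,
   taken componentwise since the library's conditional expectation is real-valued. *)
definition vec_cond_exp ::
  "'s measure \<Rightarrow> ('s \<Rightarrow> real ^ 'd) \<Rightarrow> ('s \<Rightarrow> real ^ 'd) \<Rightarrow> 's \<Rightarrow> real ^ 'd" where
  "vec_cond_exp M X Y \<omega> =
     (\<chi> j. real_cond_exp M (vimage_algebra (space M) Y borel) (\<lambda>\<omega>'. X \<omega>' $ j) \<omega>)"

(* X is a stochastic gradient of F evaluated at the random point W. *)
definition bounded_stochastic_gradient ::
  "'s measure \<Rightarrow> (real ^ 'd \<Rightarrow> real) \<Rightarrow> real \<Rightarrow> ('s \<Rightarrow> real ^ 'd) \<Rightarrow> ('s \<Rightarrow> real ^ 'd) \<Rightarrow> bool" where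
  "bounded_stochastic_gradient M F G W X \<longleftrightarrow>
     (AE \<omega> in M. vec_cond_exp M X W \<omega> = gradient F (W \<omega>)) \<and>
     prob_space.expectation M (\<lambda>\<omega>. (norm (X \<omega>))\<^sup>2) \<le> G\<^sup>2"

definition gradient_convex :: "('v::real_inner \<Rightarrow> real) \<Rightarrow> bool" where
  "gradient_convex F \<longleftrightarrow> (\<forall>v v'. F v \<ge> F v' + gradient F v' \<bullet> (v - v'))"

end

theory Submission
  imports Defs "HOL-Analysis.Harmonic_Numbers"
begin

text \<open>
  Since a coordinate masked out of the update stays in the memory, summing over the workers gives
  \<open>w\<^sub>t\<^sub>+\<^sub>1 = w\<^sub>t - \<eta>\<^sub>t (g\<^sub>t + u\<^sub>t - u\<^sub>t\<^sub>+\<^sub>1)\<close> whatever the masks are. With the given \<open>\<rho>\<close> and \<open>\<eta>\<close>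
  the momentum cancels from the auxiliary sequence, which obeys
  \<open>z\<^sub>t\<^sub>+\<^sub>1 = z\<^sub>t - a\<^sub>t X\<^sub>t + (\<eta>\<^sub>t - \<eta>\<^sub>t\<^sub>+\<^sub>1) u\<^sub>t\<^sub>+\<^sub>1\<close>, where \<open>a\<^sub>t = 1 / sqrt (t + 1)\<close> and \<open>X\<^sub>t\<close> is the aggregated
  mini-batch gradient. One expands \<open>norm (z\<^sub>t\<^sub>+\<^sub>1 - w\<^sup>*)\<^sup>2\<close>, uses convexity at \<open>w\<^sub>t\<close>, and bounds every
  error term by \<open>a\<^sub>t\<^sup>2 = 1 / (t + 1)\<close> times a constant, because \<open>\<bar>\<eta>\<^sub>t - \<eta>\<^sub>t\<^sub>+\<^sub>1\<bar> \<le> a\<^sub>t\<^sup>2\<close> and the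
  \<open>L\<^sup>2\<close> norm of \<open>z\<^sub>t - w\<^sub>t\<close> is \<open>O(a\<^sub>t)\<close>; the geometric series in \<open>\<beta>\<close> bounds the momentum.
  As the training set is finite, the second-moment bound makes the sample gradients uniformly
  bounded, so each iterate is a bounded random variable and all expectations exist.
\<close>

subsection \<open>Bounded random vectors\<close>

text \<open>Boundedness is demanded at every point of \<open>space M\<close>, not almost everywhere,
  because \<open>M_DSGD\<close> states its recursion pointwise there. Unlike integrability it is
  inherited by products, so it passes through masks, squared norms and inner products.\<close>

definition bounded_rv :: "'s measure \<Rightarrow> ('s \<Rightarrow> 'v::euclidean_space) \<Rightarrow> bool" where
  "bounded_rv M X \<longleftrightarrow> X \<in> borel_measurable M \<and> bounded (X ` space M)"

lemma bounded_rv_measurable: "bounded_rv M X \<Longrightarrow> X \<in> borel_measurable M"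
  by (simp add: bounded_rv_def)

lemma bounded_rvI:
  assumes "X \<in> borel_measurable M" "\<And>\<omega>. \<omega> \<in> space M \<Longrightarrow> norm (X \<omega>) \<le> K"
  shows "bounded_rv M X"
  using assms unfolding bounded_rv_def bounded_iff by auto

lemma bounded_rvE:
  assumes "bounded_rv M X"
  obtains K where "K \<ge> 0" "\<And>\<omega>. \<omega> \<in> space M \<Longrightarrow> norm (X \<omega>) \<le> K"
proof -
  obtain K where "\<And>\<omega>. \<omega> \<in> space M \<Longrightarrow> norm (X \<omega>) \<le> K"
    using assms unfolding bounded_rv_def bounded_iff by auto
  then show ?thesis
    using that[of "max K 0"] by force
qed

lemma bounded_rv_cong:
  assumes "\<And>\<omega>. \<omega> \<in> space M \<Longrightarrow> X \<omega> = Y \<omega>"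
  shows "bounded_rv M X \<longleftrightarrow> bounded_rv M Y"
proof -
  have "X ` space M = Y ` space M" using assms by (auto simp: image_iff)
  then show ?thesis using measurable_cong[of M X Y borel, OF assms] by (simp add: bounded_rv_def)
qed

lemma bounded_rv_const: "bounded_rv M (\<lambda>_. c)"
  by (rule bounded_rvI[of _ _ "norm c"]) auto

lemma bounded_rv_add:
  assumes "bounded_rv M X" "bounded_rv M Y"
  shows "bounded_rv M (\<lambda>\<omega>. X \<omega> + Y \<omega>)"
  using assms unfolding bounded_rv_def by (auto intro: bounded_plus_comp)

lemma bounded_rv_diff:
  assumes "bounded_rv M X" "bounded_rv M Y"
  shows "bounded_rv M (\<lambda>\<omega>. X \<omega> - Y \<omega>)"
  using assms unfolding bounded_rv_def by (auto intro: bounded_minus_comp)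

lemma bounded_rv_scaleR:
  assumes "bounded_rv M X" "bounded_rv M Y"
  shows "bounded_rv M (\<lambda>\<omega>. X \<omega> *\<^sub>R Y \<omega>)"
proof -
  obtain K where K: "K \<ge> 0" "\<And>\<omega>. \<omega> \<in> space M \<Longrightarrow> \<bar>X \<omega>\<bar> \<le> K"
    using bounded_rvE[OF assms(1)] by (metis real_norm_def)
  obtain L where L: "L \<ge> 0" "\<And>\<omega>. \<omega> \<in> space M \<Longrightarrow> norm (Y \<omega>) \<le> L"
    using bounded_rvE[OF assms(2)] by blast
  show ?thesis
    using assms K L
    by (intro bounded_rvI[of _ _ "K * L"]) (auto simp: bounded_rv_def intro!: mult_mono)
qed

lemma bounded_rv_sum:
  assumes "\<And>i. i \<in> S \<Longrightarrow> bounded_rv M (X i)"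
  shows "bounded_rv M (\<lambda>\<omega>. \<Sum>i\<in>S. X i \<omega>)"
  using assms
  by (induction S rule: infinite_finite_induct) (auto intro: bounded_rv_const bounded_rv_add)

lemma bounded_rv_inner:
  assumes "bounded_rv M X" "bounded_rv M Y"
  shows "bounded_rv M (\<lambda>\<omega>. X \<omega> \<bullet> Y \<omega>)"
proof -
  obtain K where K: "K \<ge> 0" "\<And>\<omega>. \<omega> \<in> space M \<Longrightarrow> norm (X \<omega>) \<le> K"
    using bounded_rvE[OF assms(1)] by blast
  obtain L where L: "L \<ge> 0" "\<And>\<omega>. \<omega> \<in> space M \<Longrightarrow> norm (Y \<omega>) \<le> L"
    using bounded_rvE[OF assms(2)] by blast
  show ?thesis
  proof (rule bounded_rvI[of _ _ "K * L"])
    show "(\<lambda>\<omega>. X \<omega> \<bullet> Y \<omega>) \<in> borel_measurable M"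
      using assms by (simp add: bounded_rv_def borel_measurable_inner)
    fix \<omega> assume "\<omega> \<in> space M"
    then have "norm (X \<omega>) * norm (Y \<omega>) \<le> K * L"
      using K L by (intro mult_mono) auto
    then show "norm (X \<omega> \<bullet> Y \<omega>) \<le> K * L"
      using Cauchy_Schwarz_ineq2[of "X \<omega>" "Y \<omega>"] by simp
  qed
qed

lemma bounded_rv_norm_power2:
  "bounded_rv M X \<Longrightarrow> bounded_rv M (\<lambda>\<omega>. (norm (X \<omega>))\<^sup>2)"
  unfolding power2_norm_eq_inner by (rule bounded_rv_inner)

lemma bounded_rv_nth:
  fixes X :: "'s \<Rightarrow> real ^ 'd"
  assumes "bounded_rv M X" shows "bounded_rv M (\<lambda>\<omega>. X \<omega> $ j)"
  using bounded_rv_inner[OF assms bounded_rv_const[of M "axis j 1"]]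
  by (simp add: inner_axis)

lemma bounded_rv_vec:
  fixes X :: "'s \<Rightarrow> real ^ 'd"
  assumes "\<And>j. bounded_rv M (\<lambda>\<omega>. X \<omega> $ j)"
  shows "bounded_rv M X"
proof -
  have "bounded_rv M (\<lambda>\<omega>. \<Sum>j\<in>UNIV. (X \<omega> $ j) *\<^sub>R axis j (1::real))"
    by (intro bounded_rv_sum bounded_rv_scaleR assms bounded_rv_const)
  moreover have "(\<Sum>j\<in>UNIV. (X \<omega> $ j) *\<^sub>R axis j (1::real)) = X \<omega>" for \<omega>
    by (simp add: vec_eq_iff sum.delta axis_def if_distrib cong: if_cong)
  ultimately show ?thesis by simp
qed

lemma bounded_rv_mult_real:
  fixes X Y :: "'s \<Rightarrow> real"
  assumes "bounded_rv M X" "bounded_rv M Y" shows "bounded_rv M (\<lambda>\<omega>. X \<omega> * Y \<omega>)"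
  using bounded_rv_scaleR[OF assms] by simp

lemma bounded_rv_mult_vec:
  fixes X Y :: "'s \<Rightarrow> real ^ 'd"
  assumes "bounded_rv M X" "bounded_rv M Y" shows "bounded_rv M (\<lambda>\<omega>. X \<omega> * Y \<omega>)"
  using assms
  by (intro bounded_rv_vec) (simp add: vector_mult_component bounded_rv_mult_real bounded_rv_nth)

lemmas bounded_rv_intros = bounded_rv_const bounded_rv_add bounded_rv_diff bounded_rv_scaleR
  bounded_rv_sum bounded_rv_inner bounded_rv_norm_power2 bounded_rv_nth bounded_rv_mult_real
  bounded_rv_mult_vec

text \<open>A bounded range has compact closure, and \<open>h\<close> is bounded on that. It serves
  for \<open>F (w t)\<close>, where \<open>F\<close> may be unbounded on the whole space.\<close>

lemma bounded_rv_continuous: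
  assumes "continuous_on UNIV h" "bounded_rv M X"
  shows "bounded_rv M (\<lambda>\<omega>. h (X \<omega>))"
  unfolding bounded_rv_def
proof
  show "(\<lambda>\<omega>. h (X \<omega>)) \<in> borel_measurable M"
    by (rule borel_measurable_continuous_on[OF assms(1) bounded_rv_measurable[OF assms(2)]])
  have "compact (h ` closure (X ` space M))"
    using assms unfolding bounded_rv_def
    by (intro compact_continuous_image)
       (auto intro: continuous_on_subset simp: compact_closure)
  then show "bounded ((\<lambda>\<omega>. h (X \<omega>)) ` space M)"
    by (rule bounded_subset[OF compact_imp_bounded]) (use closure_subset in fastforce)
qed

lemma (in prob_space) integrable_bounded_rv:
  fixes X :: "'a \<Rightarrow> real"
  assumes "bounded_rv M X" shows "integrable M X"
proof -
  obtain K where K: "\<And>\<omega>. \<omega> \<in> space M \<Longrightarrow> norm (X \<omega>) \<le> K"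
    using bounded_rvE[OF assms] by blast
  show ?thesis
    by (rule integrable_const_bound[where B = K])
       (use K assms bounded_rv_measurable in auto)
qed

text \<open>Cauchy-Schwarz in L^2, with upper bounds \<open>A\<close> and \<open>B\<close> in place
  of the norms. It comes from a weighted Young inequality whose weights \<open>b / a\<close> and
  \<open>a / b\<close> balance the two squares.\<close>

lemma (in prob_space) expectation_inner_le:
  fixes X Y :: "'a \<Rightarrow> 'v::euclidean_space"
  assumes X: "bounded_rv M X" and Y: "bounded_rv M Y" and "A \<ge> 0" "B \<ge> 0"
    and EX: "expectation (\<lambda>\<omega>. (norm (X \<omega>))\<^sup>2) \<le> A\<^sup>2"
    and EY: "expectation (\<lambda>\<omega>. (norm (Y \<omega>))\<^sup>2) \<le> B\<^sup>2"
  shows "expectation (\<lambda>\<omega>. X \<omega> \<bullet> Y \<omega>) \<le> A * B"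
proof -
  \<comment> \<open>Shifting by \<open>e\<close> keeps the weights defined when \<open>A\<close> or
    \<open>B\<close> is 0; at the end \<open>e\<close> tends to 0.\<close>
  have ineq: "expectation (\<lambda>\<omega>. X \<omega> \<bullet> Y \<omega>) \<le> (A + e) * (B + e)" if "e > 0" for e
  proof -
    define a b where "a = A + e" and "b = B + e"
    have pos: "a > 0" "b > 0" using that assms by (auto simp: a_def b_def)
    have "x \<bullet> y \<le> (b / a * (norm x)\<^sup>2 + a / b * (norm y)\<^sup>2) / 2" for x y :: 'v
    proof -
      have "0 \<le> (norm (b *\<^sub>R x - a *\<^sub>R y))\<^sup>2" by simp
      also have "\<dots> = b\<^sup>2 * (norm x)\<^sup>2 + a\<^sup>2 * (norm y)\<^sup>2 - 2 * (a * b) * (x \<bullet> y)"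
        unfolding power2_norm_eq_inner
        by (simp add: inner_diff_left inner_diff_right inner_commute power2_eq_square algebra_simps)
      finally show ?thesis using pos by (simp add: field_simps power2_eq_square)
    qed
    then have "expectation (\<lambda>\<omega>. X \<omega> \<bullet> Y \<omega>) \<le>
      expectation (\<lambda>\<omega>. (b / a * (norm (X \<omega>))\<^sup>2 + a / b * (norm (Y \<omega>))\<^sup>2) / 2)"
      using integrable_bounded_rv[OF bounded_rv_norm_power2[OF X]]
        integrable_bounded_rv[OF bounded_rv_norm_power2[OF Y]]
        integrable_bounded_rv[OF bounded_rv_inner[OF X Y]]
      by (intro integral_mono) auto
    also have "\<dots> = (b / a * expectation (\<lambda>\<omega>. (norm (X \<omega>))\<^sup>2)
        + a / b * expectation (\<lambda>\<omega>. (norm (Y \<omega>))\<^sup>2)) / 2"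
      using integrable_bounded_rv[OF bounded_rv_norm_power2[OF X]]
        integrable_bounded_rv[OF bounded_rv_norm_power2[OF Y]] by simp
    also have "\<dots> \<le> (b / a * a\<^sup>2 + a / b * b\<^sup>2) / 2"
    proof -
      have "A\<^sup>2 \<le> a\<^sup>2" "B\<^sup>2 \<le> b\<^sup>2" using that assms by (auto simp: a_def b_def intro!: power_mono)
      then show ?thesis
        using EX EY pos by (intro divide_right_mono add_mono mult_left_mono) auto
    qed
    also have "\<dots> = a * b" using pos by (simp add: field_simps power2_eq_square)
    finally show ?thesis by (simp add: a_def b_def)
  qed
  have "((\<lambda>e. (A + e) * (B + e)) \<longlongrightarrow> (A + 0) * (B + 0)) (at_right 0)"
    by (intro tendsto_intros)
  then have "expectation (\<lambda>\<omega>. X \<omega> \<bullet> Y \<omega>) \<le> (A + 0) * (B + 0)"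
    by (rule tendsto_lowerbound)
       (use ineq in \<open>auto intro: eventually_mono[OF eventually_at_right_less]\<close>)
  then show ?thesis by simp
qed

text \<open>Minkowski's inequality in L^2: the cross term of the expanded square is controlled by
  \<open>expectation_inner_le\<close>.\<close>

lemma (in prob_space) expectation_norm_add_le:
  fixes X Y :: "'a \<Rightarrow> 'v::euclidean_space"
  assumes X: "bounded_rv M X" and Y: "bounded_rv M Y" and "A \<ge> 0" "B \<ge> 0"
    and EX: "expectation (\<lambda>\<omega>. (norm (X \<omega>))\<^sup>2) \<le> A\<^sup>2"
    and EY: "expectation (\<lambda>\<omega>. (norm (Y \<omega>))\<^sup>2) \<le> B\<^sup>2"
  shows "expectation (\<lambda>\<omega>. (norm (X \<omega> + Y \<omega>))\<^sup>2) \<le> (A + B)\<^sup>2"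
proof -
  have "expectation (\<lambda>\<omega>. (norm (X \<omega> + Y \<omega>))\<^sup>2)
      = expectation (\<lambda>\<omega>. (norm (X \<omega>))\<^sup>2 + (norm (Y \<omega>))\<^sup>2 + 2 * (X \<omega> \<bullet> Y \<omega>))"
    by (simp add: power2_norm_eq_inner inner_add_left inner_add_right inner_commute algebra_simps)
  also have "\<dots> = expectation (\<lambda>\<omega>. (norm (X \<omega>))\<^sup>2) + expectation (\<lambda>\<omega>. (norm (Y \<omega>))\<^sup>2)
      + 2 * expectation (\<lambda>\<omega>. X \<omega> \<bullet> Y \<omega>)"
    using integrable_bounded_rv[OF bounded_rv_norm_power2[OF X]]
      integrable_bounded_rv[OF bounded_rv_norm_power2[OF Y]]
      integrable_bounded_rv[OF bounded_rv_inner[OF X Y]] by simp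
  also have "\<dots> \<le> A\<^sup>2 + B\<^sup>2 + 2 * (A * B)"
    using EX EY expectation_inner_le[OF assms] by simp
  also have "\<dots> = (A + B)\<^sup>2" by (simp add: power2_eq_square algebra_simps)
  finally show ?thesis .
qed

subsection \<open>Measurability of gradients\<close>

text \<open>\<open>gradient\<close> is a definite description, so a representing vector has to be
  exhibited. It is assembled from the values of the linear derivative on \<open>Basis\<close>;
  uniqueness is \<open>gradient_eq\<close>.\<close>

lemma differentiable_imp_GDERIV_gradient:
  fixes h :: "'v::euclidean_space \<Rightarrow> real"
  assumes "h differentiable (at x)"
  shows "GDERIV h x :> gradient h x"
proof -
  obtain h' where h': "(h has_derivative h') (at x)"
    using assms by (auto simp: differentiable_def)
  have "h' y = y \<bullet> (\<Sum>e\<in>Basis. h' e *\<^sub>R e)" for y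
  proof -
    interpret linear h' using h' by (rule has_derivative_linear)
    have "h' y = h' (\<Sum>e\<in>Basis. (y \<bullet> e) *\<^sub>R e)" by (simp add: euclidean_representation)
    also have "\<dots> = (\<Sum>e\<in>Basis. (y \<bullet> e) * h' e)" by (simp add: sum scale)
    finally show ?thesis by (simp add: inner_sum_right mult.commute)
  qed
  then have "h' = (\<lambda>y. y \<bullet> (\<Sum>e\<in>Basis. h' e *\<^sub>R e))" by blast
  then have "GDERIV h x :> (\<Sum>e\<in>Basis. h' e *\<^sub>R e)"
    using h' by (simp add: gderiv_def)
  then show ?thesis using gradient_eq by metis
qed

text \<open>Differentiability does not make the gradient continuous, but each of its components is a
  pointwise limit of difference quotients of the continuous \<open>h\<close>, here with steps
  \<open>1 / Suc k\<close>.\<close>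

lemma borel_measurable_gradient:
  fixes h :: "'v::euclidean_space \<Rightarrow> real"
  assumes "\<And>x. h differentiable (at x)"
  shows "gradient h \<in> borel_measurable borel"
proof (subst borel_measurable_euclidean_space, intro ballI)
  fix e :: 'v assume "e \<in> Basis"
  have "continuous_on UNIV h"
    using assms by (simp add: continuous_at_imp_continuous_on differentiable_imp_continuous_within)
  then have h[measurable]: "h \<in> borel_measurable borel"
    by (rule borel_measurable_continuous_onI)
  show "(\<lambda>x. gradient h x \<bullet> e) \<in> borel_measurable borel"
  proof (rule borel_measurable_LIMSEQ_real)
    show "(\<lambda>x. (h (x + (1 / real (Suc k)) *\<^sub>R e) - h x) / (1 / real (Suc k)))
        \<in> borel_measurable borel" for k
      by measurable
    fix x :: 'v
    have line: "((\<lambda>s::real. x + s *\<^sub>R e) has_derivative (\<lambda>s. s *\<^sub>R e)) (at 0)"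
      by (auto intro!: derivative_eq_intros)
    \<comment> \<open>The base point is written as the value of the line at 0, where the chain rule
      is applied.\<close>
    have h': "(h has_derivative (\<lambda>y. y \<bullet> gradient h x)) (at (x + 0 *\<^sub>R e))"
      using differentiable_imp_GDERIV_gradient[OF assms, of x] by (simp add: gderiv_def)
    have "((\<lambda>s. h (x + s *\<^sub>R e)) has_derivative (\<lambda>s. (s *\<^sub>R e) \<bullet> gradient h x)) (at 0)"
      by (rule has_derivative_compose[OF line h'])
    moreover have "(\<lambda>s. (s *\<^sub>R e) \<bullet> gradient h x) = (*) (gradient h x \<bullet> e)"
      by (auto simp: inner_commute)
    ultimately have "((\<lambda>s. h (x + s *\<^sub>R e)) has_field_derivative (gradient h x \<bullet> e)) (at 0)"
      by (simp only: has_field_derivative_def)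
    then have "(\<lambda>s. (h (x + s *\<^sub>R e) - h x) / s) \<midarrow>0\<rightarrow> gradient h x \<bullet> e"
      by (simp add: DERIV_def)
    moreover have "filterlim (\<lambda>k. 1 / real (Suc k)) (at 0) sequentially"
      using LIMSEQ_inverse_real_of_nat
      by (auto simp: filterlim_at inverse_eq_divide)
    ultimately show "(\<lambda>k. (h (x + (1 / real (Suc k)) *\<^sub>R e) - h x) / (1 / real (Suc k)))
        \<longlonglongrightarrow> gradient h x \<bullet> e"
      by (rule filterlim_compose)
  qed
qed

subsection \<open>The M-DSGD iterates\<close>

text \<open>Replaces a sum over a random multiset by one over a fixed finite set with random
  coefficients, a form in which measurability can be checked term by term.\<close>

lemma sum_mset_eq_sum_count:
  fixes h :: "'i \<Rightarrow> 'v::real_vector"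
  assumes "finite S" "set_mset A \<subseteq> S"
  shows "(\<Sum>i\<in>#A. h i) = (\<Sum>i\<in>S. real (count A i) *\<^sub>R h i)"
  using assms(2)
proof (induction A)
  case (add x A)
  have "(\<Sum>i\<in>S. real (count (add_mset x A) i) *\<^sub>R h i)
      = (\<Sum>i\<in>S. real (count A i) *\<^sub>R h i + (if i = x then h i else 0))"
    by (intro sum.cong) (auto simp: algebra_simps)
  also have "\<dots> = (\<Sum>i\<in>S. real (count A i) *\<^sub>R h i) + h x"
    using add.prems assms(1) by (simp add: sum.distrib)
  finally show ?case using add by (simp add: add.commute)
qed simp

lemma bounded_rv_sum_mset:
  fixes h :: "'i \<Rightarrow> 'v::euclidean_space \<Rightarrow> 'w::euclidean_space"
  assumes J: "J \<in> measurable M (count_space UNIV)" "finite S"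
      "\<And>\<omega>. \<omega> \<in> space M \<Longrightarrow> size (J \<omega>) \<le> b \<and> set_mset (J \<omega>) \<subseteq> S"
    and h: "\<And>i. i \<in> S \<Longrightarrow> bounded_rv M (\<lambda>\<omega>. h i (W \<omega>))"
  shows "bounded_rv M (\<lambda>\<omega>. \<Sum>i\<in>#J \<omega>. h i (W \<omega>))"
proof -
  have "bounded_rv M (\<lambda>\<omega>. real (count (J \<omega>) i))" for i
  proof (rule bounded_rvI[of _ _ b])
    show "(\<lambda>\<omega>. real (count (J \<omega>) i)) \<in> borel_measurable M"
      by (rule measurable_compose[OF J(1)]) simp
    show "norm (real (count (J \<omega>) i)) \<le> real b" if "\<omega> \<in> space M" for \<omega>
      using J(3)[OF that] count_le_size[of "J \<omega>" i] by simp
  qed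
  then have "bounded_rv M (\<lambda>\<omega>. \<Sum>i\<in>S. real (count (J \<omega>) i) *\<^sub>R h i (W \<omega>))"
    using h by (intro bounded_rv_sum bounded_rv_scaleR)
  moreover have "(\<Sum>i\<in>#J \<omega>. h i (W \<omega>)) = (\<Sum>i\<in>S. real (count (J \<omega>) i) *\<^sub>R h i (W \<omega>))"
    if "\<omega> \<in> space M" for \<omega>
    by (rule sum_mset_eq_sum_count) (use J that in auto)
  ultimately show ?thesis by (subst bounded_rv_cong) auto
qed

text \<open>The source of integrability for everything below. The bounds may grow with
  \<open>t\<close> and never enter an estimate. For a batch gradient only measurability is taken
  from \<open>w t\<close>; its size is controlled by \<open>b\<close> and \<open>K\<close>.\<close>

lemma M_DSGD_bounded_rv:
  fixes w :: "nat \<Rightarrow> 's \<Rightarrow> real ^ 'd"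
  assumes alg: "M_DSGD M f \<zeta> n p b \<beta> \<eta> w0 I m g u w"
    and grad: "\<And>i. i \<in> {1..n} \<Longrightarrow> sample_gradient f \<zeta> i \<in> borel_measurable borel"
      "\<And>i v. i \<in> {1..n} \<Longrightarrow> norm (sample_gradient f \<zeta> i v) \<le> K"
  shows "bounded_rv M (w t)"
    and "k \<in> {1..p} \<Longrightarrow> bounded_rv M (g (int t - 1) k)"
    and "k \<in> {1..p} \<Longrightarrow> bounded_rv M (u t k)"
    and "k \<in> {1..p} \<Longrightarrow> bounded_rv M (\<lambda>\<omega>. \<Sum>i\<in>#I t k \<omega>. sample_gradient f \<zeta> i (w t \<omega>))"
proof -
  have batch: "bounded_rv M (\<lambda>\<omega>. \<Sum>i\<in>#I t k \<omega>. sample_gradient f \<zeta> i (w t \<omega>))"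
    if "bounded_rv M (w t)" "k \<in> {1..p}" for t k
  proof (rule bounded_rv_sum_mset[where S = "{1..n}" and b = b])
    show "bounded_rv M (\<lambda>\<omega>. sample_gradient f \<zeta> i (w t \<omega>))" if "i \<in> {1..n}" for i
      using grad that \<open>bounded_rv M (w t)\<close>
      by (intro bounded_rvI[of _ _ K]) (auto intro: measurable_compose[OF bounded_rv_measurable])
  qed (use alg that in \<open>auto simp: M_DSGD_def\<close>)
  have mask: "bounded_rv M (m t k)" if "k \<in> {1..p}" for t k
  proof -
    have m: "m t k \<in> borel_measurable M" "\<And>\<omega> j. \<omega> \<in> space M \<Longrightarrow> m t k \<omega> $ j \<in> {0, 1}"
      using alg that unfolding M_DSGD_def by blast+
    have "bounded_rv M (\<lambda>\<omega>. m t k \<omega> $ j)" for j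
    proof (rule bounded_rvI[of _ _ 1])
      show "(\<lambda>\<omega>. m t k \<omega> $ j) \<in> borel_measurable M"
        by (rule borel_measurable_continuous_on[OF _ m(1)]) (intro continuous_intros)
      show "norm (m t k \<omega> $ j) \<le> 1" if "\<omega> \<in> space M" for \<omega>
        using m(2)[OF that, of j] by auto
    qed
    then show ?thesis by (rule bounded_rv_vec)
  qed
  \<comment> \<open>The shifted index \<open>int t - 1\<close> collects the state just before
    iteration \<open>t\<close>, so the base case consists of the initial values, including the one
    at -1.\<close>
  have all: "bounded_rv M (w t) \<and>
      (\<forall>k\<in>{1..p}. bounded_rv M (g (int t - 1) k) \<and> bounded_rv M (u t k))" for t
  proof (induction t)
    case 0
    have "w 0 \<omega> = w0" if "\<omega> \<in> space M" for \<omega>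
      using alg that unfolding M_DSGD_def by blast
    moreover have "g (-1) k \<omega> = 0" "u 0 k \<omega> = 0" if "\<omega> \<in> space M" "k \<in> {1..p}" for \<omega> k
      using alg that unfolding M_DSGD_def by blast+
    ultimately show ?case
      by (simp add: bounded_rv_const cong: bounded_rv_cong)
  next
    case (Suc t)
    have g: "bounded_rv M (g (int t) k)" if "k \<in> {1..p}" for k
    proof -
      have "g (int t) k \<omega> = \<beta> *\<^sub>R g (int t - 1) k \<omega> + (1 / (real p * real b)) *\<^sub>R
          (\<Sum>i\<in>#I t k \<omega>. sample_gradient f \<zeta> i (w t \<omega>))" if "\<omega> \<in> space M" for \<omega>
        using alg that \<open>k \<in> {1..p}\<close> unfolding M_DSGD_def by blast
      moreover have "bounded_rv M (\<lambda>\<omega>. \<beta> *\<^sub>R g (int t - 1) k \<omega> + (1 / (real p * real b)) *\<^sub>R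
          (\<Sum>i\<in>#I t k \<omega>. sample_gradient f \<zeta> i (w t \<omega>)))"
        using Suc that batch by (intro bounded_rv_intros) auto
      ultimately show ?thesis by (subst bounded_rv_cong) auto
    qed
    have u: "bounded_rv M (u (Suc t) k)" if "k \<in> {1..p}" for k
    proof -
      have "u (Suc t) k \<omega> = (1 - m t k \<omega>) * (g (int t) k \<omega> + u t k \<omega>)" if "\<omega> \<in> space M" for \<omega>
        using alg that \<open>k \<in> {1..p}\<close> unfolding M_DSGD_def by blast
      moreover have "bounded_rv M (\<lambda>\<omega>. (1 - m t k \<omega>) * (g (int t) k \<omega> + u t k \<omega>))"
        using Suc that g mask by (intro bounded_rv_intros) auto
      ultimately show ?thesis by (subst bounded_rv_cong) auto
    qed
    have "w (Suc t) \<omega> = w t \<omega> - \<eta> t *\<^sub>R (\<Sum>k=1..p. m t k \<omega> * (g (int t) k \<omega> + u t k \<omega>))"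
      if "\<omega> \<in> space M" for \<omega>
      using alg that unfolding M_DSGD_def by blast
    moreover have "bounded_rv M
        (\<lambda>\<omega>. w t \<omega> - \<eta> t *\<^sub>R (\<Sum>k=1..p. m t k \<omega> * (g (int t) k \<omega> + u t k \<omega>)))"
      using Suc g mask by (intro bounded_rv_intros) auto
    ultimately have "bounded_rv M (w (Suc t))" by (subst bounded_rv_cong) auto
    then show ?case using g u by simp
  qed
  then show "bounded_rv M (w t)"
    and "k \<in> {1..p} \<Longrightarrow> bounded_rv M (g (int t - 1) k)"
    and "k \<in> {1..p} \<Longrightarrow> bounded_rv M (u t k)"
    and "k \<in> {1..p} \<Longrightarrow> bounded_rv M (\<lambda>\<omega>. \<Sum>i\<in>#I t k \<omega>. sample_gradient f \<zeta> i (w t \<omega>))"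
    using batch by auto
qed

lemma M_DSGD_sum_g:
  assumes "M_DSGD M f \<zeta> n p b \<beta> \<eta> w0 I m g u w" "\<omega> \<in> space M"
  shows "(\<Sum>k=1..p. g (int t) k \<omega>) = \<beta> *\<^sub>R (\<Sum>k=1..p. g (int t - 1) k \<omega>)
    + minibatch_gradient f \<zeta> p b (\<lambda>k. I t k \<omega>) (w t \<omega>)"
proof -
  have "g (int t) k \<omega> = \<beta> *\<^sub>R g (int t - 1) k \<omega> + (1 / (real p * real b)) *\<^sub>R
      (\<Sum>i\<in>#I t k \<omega>. sample_gradient f \<zeta> i (w t \<omega>))" if "k \<in> {1..p}" for k
    using assms that unfolding M_DSGD_def by blast
  then show ?thesis
    by (simp add: minibatch_gradient_def sum.distrib scaleR_sum_right)
qed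

text \<open>With \<open>v = g + u\<close>, the transmitted part is
  \<open>m * v = v - (1 - m) * v\<close>, and the subtracted part is exactly the next
  memory.\<close>

lemma M_DSGD_w_step:
  assumes "M_DSGD M f \<zeta> n p b \<beta> \<eta> w0 I m g u w" "\<omega> \<in> space M"
  shows "w (Suc t) \<omega> = w t \<omega> - \<eta> t *\<^sub>R
    ((\<Sum>k=1..p. g (int t) k \<omega>) + (\<Sum>k=1..p. u t k \<omega>) - (\<Sum>k=1..p. u (Suc t) k \<omega>))"
proof -
  have "u (Suc t) k \<omega> = (1 - m t k \<omega>) * (g (int t) k \<omega> + u t k \<omega>)" if "k \<in> {1..p}" for k
    using assms that unfolding M_DSGD_def by blast
  then have "(\<Sum>k=1..p. m t k \<omega> * (g (int t) k \<omega> + u t k \<omega>))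
      = (\<Sum>k=1..p. g (int t) k \<omega> + u t k \<omega> - u (Suc t) k \<omega>)"
    by (intro sum.cong refl) (simp add: algebra_simps)
  moreover have "w (Suc t) \<omega> =
      w t \<omega> - \<eta> t *\<^sub>R (\<Sum>k=1..p. m t k \<omega> * (g (int t) k \<omega> + u t k \<omega>))"
    using assms unfolding M_DSGD_def by blast
  ultimately show ?thesis by (simp add: sum.distrib sum_subtractf)
qed

subsection \<open>One step of the descent\<close>

text \<open>Convexity bounds the gap by the inner product of \<open>gradient F (W \<omega>)\<close>
  with \<open>W \<omega> - v\<close>. The gradient is the conditional expectation of
  \<open>X\<close> given \<open>W\<close>, and \<open>W - v\<close> is a function of
  \<open>W\<close>, so in expectation \<open>X\<close> may take its place.\<close>

lemma (in prob_space) expectation_suboptimality_le: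
  fixes W X :: "'a \<Rightarrow> real ^ 'd"
  assumes X: "bounded_rv M X" and W: "bounded_rv M W" and FW: "bounded_rv M (\<lambda>\<omega>. F (W \<omega>))"
    and convex: "gradient_convex F" and sg: "bounded_stochastic_gradient M F G W X"
  shows "expectation (\<lambda>\<omega>. F (W \<omega>) - F v) \<le> expectation (\<lambda>\<omega>. X \<omega> \<bullet> (W \<omega> - v))"
proof -
  define N where "N = vimage_algebra (space M) W borel"
  have "subalgebra M N"
    unfolding subalgebra_def N_def
    using bounded_rv_measurable[OF W] by (simp add: sets_vimage_algebra2 measurable_sets subset_iff)
      (auto simp: measurable_sets)
  then interpret finite_measure_subalgebra M N by unfold_locales
  have WN: "W \<in> borel_measurable N"
    unfolding N_def by (rule measurable_vimage_algebra1) simp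
  define H where "H \<omega> j = (W \<omega> $ j - v $ j) * real_cond_exp M N (\<lambda>\<omega>'. X \<omega>' $ j) \<omega>" for \<omega> j
  have WXj: "bounded_rv M (\<lambda>\<omega>. (W \<omega> $ j - v $ j) * X \<omega> $ j)" for j
    by (intro bounded_rv_intros W X)
  have "(\<lambda>\<omega>. W \<omega> $ j) \<in> borel_measurable N" for j
    by (rule borel_measurable_continuous_on[OF _ WN]) (intro continuous_intros)
  then have WjN: "(\<lambda>\<omega>. W \<omega> $ j - v $ j) \<in> borel_measurable N" for j
    by simp
  \<comment> \<open>The factor \<open>W \<omega> $ j - v $ j\<close> is measurable for
    \<open>N\<close>, the sigma-algebra of \<open>W\<close>, and can therefore be moved inside the
    conditional expectation, coordinate by coordinate.\<close>
  note cond = real_cond_exp_intg[OF integrable_bounded_rv[OF WXj] WjN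
      bounded_rv_measurable[OF bounded_rv_nth[OF X]]]
  have int_H: "integrable M (\<lambda>\<omega>. H \<omega> j)"
    and E_H: "expectation (\<lambda>\<omega>. H \<omega> j) = expectation (\<lambda>\<omega>. (W \<omega> $ j - v $ j) * X \<omega> $ j)" for j
    using cond unfolding H_def by auto
  have "AE \<omega> in M. F (W \<omega>) - F v \<le> (\<Sum>j\<in>UNIV. H \<omega> j)"
    using conjunct1[OF sg[unfolded bounded_stochastic_gradient_def]]
  proof eventually_elim
    case (elim \<omega>)
    have "F v \<ge> F (W \<omega>) + gradient F (W \<omega>) \<bullet> (v - W \<omega>)"
      using convex unfolding gradient_convex_def by blast
    then have "F (W \<omega>) - F v \<le> gradient F (W \<omega>) \<bullet> (W \<omega> - v)"
      by (simp add: inner_diff_right)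
    also have "\<dots> = (\<Sum>j\<in>UNIV. H \<omega> j)"
      unfolding elim[symmetric]
      by (simp add: inner_vec_def vec_cond_exp_def H_def N_def mult.commute)
    finally show ?case .
  qed
  then have "expectation (\<lambda>\<omega>. F (W \<omega>) - F v) \<le> expectation (\<lambda>\<omega>. \<Sum>j\<in>UNIV. H \<omega> j)"
    using int_H integrable_bounded_rv[OF FW] by (intro integral_mono_AE) auto
  also have "\<dots> = (\<Sum>j\<in>UNIV. expectation (\<lambda>\<omega>. (W \<omega> $ j - v $ j) * X \<omega> $ j))"
    using int_H by (simp add: E_H)
  also have "\<dots> = expectation (\<lambda>\<omega>. X \<omega> \<bullet> (W \<omega> - v))"
    using integrable_bounded_rv[OF WXj] by (simp add: inner_vec_def mult.commute)
  finally show ?thesis .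
qed

text \<open>By Minkowski the L^2 norm \<open>r\<close> of \<open>S t\<close> becomes at most
  \<open>\<beta> * r + G\<close> in one step, and \<open>G / (1 - \<beta>)\<close> is the fixed
  point of this map.\<close>

lemma (in prob_space) expectation_momentum_le:
  fixes S X :: "nat \<Rightarrow> 'a \<Rightarrow> 'v::euclidean_space"
  assumes "0 \<le> \<beta>" "\<beta> < 1" "G \<ge> 0"
    and S: "\<And>t. bounded_rv M (S t)" and X: "\<And>t. bounded_rv M (X t)"
    and init: "\<And>\<omega>. \<omega> \<in> space M \<Longrightarrow> S 0 \<omega> = 0"
    and step: "\<And>t \<omega>. \<omega> \<in> space M \<Longrightarrow> S (Suc t) \<omega> = \<beta> *\<^sub>R S t \<omega> + X t \<omega>"
    and EX: "\<And>t. expectation (\<lambda>\<omega>. (norm (X t \<omega>))\<^sup>2) \<le> G\<^sup>2"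
  shows "expectation (\<lambda>\<omega>. (norm (S t \<omega>))\<^sup>2) \<le> (G / (1 - \<beta>))\<^sup>2"
proof (induction t)
  case 0
  have "expectation (\<lambda>\<omega>. (norm (S 0 \<omega>))\<^sup>2) = expectation (\<lambda>\<omega>. 0)"
    by (rule Bochner_Integration.integral_cong) (auto simp: init)
  then show ?case by simp
next
  case (Suc t)
  have "expectation (\<lambda>\<omega>. (norm (\<beta> *\<^sub>R S t \<omega>))\<^sup>2) \<le> (\<beta> * (G / (1 - \<beta>)))\<^sup>2"
    using mult_left_mono[OF Suc, of "\<beta>\<^sup>2"] by (simp add: power_mult_distrib power_divide)
  then have "expectation (\<lambda>\<omega>. (norm (\<beta> *\<^sub>R S t \<omega> + X t \<omega>))\<^sup>2) \<le> (\<beta> * (G / (1 - \<beta>)) + G)\<^sup>2"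
    using assms by (intro expectation_norm_add_le bounded_rv_intros) auto
  moreover have "\<beta> * (G / (1 - \<beta>)) + G = G / (1 - \<beta>)"
    using assms by (simp add: field_simps)
  moreover have "expectation (\<lambda>\<omega>. (norm (S (Suc t) \<omega>))\<^sup>2)
      = expectation (\<lambda>\<omega>. (norm (\<beta> *\<^sub>R S t \<omega> + X t \<omega>))\<^sup>2)"
    by (rule Bochner_Integration.integral_cong) (auto simp: step)
  ultimately show ?case by simp
qed

text \<open>The parallelogram law with one square dropped. It produces the summands
  \<open>2 * G\<^sup>2\<close> and \<open>2 * U\<^sup>2\<close> of \<open>C\<close> and the factors
  2 under its square root.\<close>

lemma norm_add_power2_le:
  fixes x y :: "'v::real_inner"
  shows "(norm (x + y))\<^sup>2 \<le> 2 * (norm x)\<^sup>2 + 2 * (norm y)\<^sup>2"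
proof -
  have "0 \<le> (norm (x - y))\<^sup>2" by simp
  then show ?thesis
    unfolding power2_norm_eq_inner
    by (simp add: inner_add_left inner_add_right inner_diff_left inner_diff_right)
qed

text \<open>The summands of the error have separate origins: \<open>2 * G * S\<close> from
  evaluating the gradient at \<open>W\<close> instead of \<open>Z\<close>, \<open>2 * U * B\<close>
  from the drift \<open>c *\<^sub>R V\<close> against \<open>Z - v\<close>, and the two squares from
  the squared increment.\<close>

lemma (in prob_space) expectation_descent_step:
  fixes Z Z' W X V :: "'a \<Rightarrow> 'v::euclidean_space" and v :: 'v
  assumes bdd: "bounded_rv M Z" "bounded_rv M W" "bounded_rv M X" "bounded_rv M V"
    and Z': "\<And>\<omega>. \<omega> \<in> space M \<Longrightarrow> Z' \<omega> = Z \<omega> - a *\<^sub>R X \<omega> + c *\<^sub>R V \<omega>"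
    and a: "0 \<le> a" "a \<le> 1" and c: "\<bar>c\<bar> \<le> a\<^sup>2"
    and nonneg: "G \<ge> 0" "U \<ge> 0" "B \<ge> 0" "S \<ge> 0"
    and EX: "expectation (\<lambda>\<omega>. (norm (X \<omega>))\<^sup>2) \<le> G\<^sup>2"
    and EV: "expectation (\<lambda>\<omega>. (norm (V \<omega>))\<^sup>2) \<le> U\<^sup>2"
    and EZ: "expectation (\<lambda>\<omega>. (norm (Z \<omega> - v))\<^sup>2) \<le> B\<^sup>2"
    and EWZ: "expectation (\<lambda>\<omega>. (norm (W \<omega> - Z \<omega>))\<^sup>2) \<le> (a * S)\<^sup>2"
    and gap: "\<delta> \<le> expectation (\<lambda>\<omega>. X \<omega> \<bullet> (W \<omega> - v))"
  shows "expectation (\<lambda>\<omega>. (norm (Z' \<omega> - v))\<^sup>2) \<le> expectation (\<lambda>\<omega>. (norm (Z \<omega> - v))\<^sup>2)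
    - 2 * a * \<delta> + a\<^sup>2 * (2 * G * S + 2 * U * B + 2 * G\<^sup>2 + 2 * U\<^sup>2)"
proof -
  \<comment> \<open>The distance is measured from \<open>z\<close> but convexity is used at
    \<open>w\<close>, hence the splitting of \<open>x \<bullet> (z - v)\<close> into
    \<open>x \<bullet> (w - v)\<close> minus \<open>x \<bullet> (w - z)\<close>.\<close>
  have split: "(norm (z - a *\<^sub>R x + c *\<^sub>R y - v))\<^sup>2 \<le> (norm (z - v))\<^sup>2
      - 2 * a * (x \<bullet> (w - v)) + 2 * a * (x \<bullet> (w - z)) + 2 * ((c *\<^sub>R y) \<bullet> (z - v))
      + 2 * a\<^sup>2 * (norm x)\<^sup>2 + 2 * c\<^sup>2 * (norm y)\<^sup>2" for z x y w :: 'v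
  proof -
    have "(norm (z - a *\<^sub>R x + c *\<^sub>R y - v))\<^sup>2 = (norm (z - v))\<^sup>2
      - 2 * a * (x \<bullet> (w - v)) + 2 * a * (x \<bullet> (w - z)) + 2 * ((c *\<^sub>R y) \<bullet> (z - v))
      + (norm ((- a) *\<^sub>R x + c *\<^sub>R y))\<^sup>2"
      unfolding power2_norm_eq_inner by (simp add: inner_commute algebra_simps)
    then show ?thesis
      using norm_add_power2_le[of "(- a) *\<^sub>R x" "c *\<^sub>R y"] by (simp add: power_mult_distrib)
  qed
  have int: "integrable M (\<lambda>\<omega>. (norm (Z \<omega> - v))\<^sup>2)" "integrable M (\<lambda>\<omega>. X \<omega> \<bullet> (W \<omega> - v))"
    "integrable M (\<lambda>\<omega>. X \<omega> \<bullet> (W \<omega> - Z \<omega>))" "integrable M (\<lambda>\<omega>. (c *\<^sub>R V \<omega>) \<bullet> (Z \<omega> - v))"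
    "integrable M (\<lambda>\<omega>. (norm (X \<omega>))\<^sup>2)" "integrable M (\<lambda>\<omega>. (norm (V \<omega>))\<^sup>2)"
    "integrable M (\<lambda>\<omega>. (norm (Z \<omega> - a *\<^sub>R X \<omega> + c *\<^sub>R V \<omega> - v))\<^sup>2)"
    by (intro integrable_bounded_rv bounded_rv_intros bdd)+
  have "expectation (\<lambda>\<omega>. (norm (Z' \<omega> - v))\<^sup>2)
      = expectation (\<lambda>\<omega>. (norm (Z \<omega> - a *\<^sub>R X \<omega> + c *\<^sub>R V \<omega> - v))\<^sup>2)"
    by (rule Bochner_Integration.integral_cong) (auto simp: Z')
  also have "\<dots> \<le> expectation (\<lambda>\<omega>. (norm (Z \<omega> - v))\<^sup>2
      - 2 * a * (X \<omega> \<bullet> (W \<omega> - v)) + 2 * a * (X \<omega> \<bullet> (W \<omega> - Z \<omega>)) + 2 * ((c *\<^sub>R V \<omega>) \<bullet> (Z \<omega> - v))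
      + 2 * a\<^sup>2 * (norm (X \<omega>))\<^sup>2 + 2 * c\<^sup>2 * (norm (V \<omega>))\<^sup>2)"
    by (intro integral_mono split Bochner_Integration.integrable_add
        Bochner_Integration.integrable_diff integrable_mult_right int)
  also have "\<dots> = expectation (\<lambda>\<omega>. (norm (Z \<omega> - v))\<^sup>2)
      - 2 * a * expectation (\<lambda>\<omega>. X \<omega> \<bullet> (W \<omega> - v)) + 2 * a * expectation (\<lambda>\<omega>. X \<omega> \<bullet> (W \<omega> - Z \<omega>))
      + 2 * expectation (\<lambda>\<omega>. (c *\<^sub>R V \<omega>) \<bullet> (Z \<omega> - v))
      + 2 * a\<^sup>2 * expectation (\<lambda>\<omega>. (norm (X \<omega>))\<^sup>2) + 2 * c\<^sup>2 * expectation (\<lambda>\<omega>. (norm (V \<omega>))\<^sup>2)"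
    using int by (simp del: inner_scaleR_left)
  also have "\<dots> \<le> expectation (\<lambda>\<omega>. (norm (Z \<omega> - v))\<^sup>2) - 2 * a * \<delta> + 2 * a * (G * (a * S))
      + 2 * (a\<^sup>2 * U * B) + 2 * a\<^sup>2 * G\<^sup>2 + 2 * a\<^sup>2 * U\<^sup>2"
  proof -
    have 1: "a * \<delta> \<le> a * expectation (\<lambda>\<omega>. X \<omega> \<bullet> (W \<omega> - v))"
      using gap a(1) by (rule mult_left_mono)
    have "expectation (\<lambda>\<omega>. X \<omega> \<bullet> (W \<omega> - Z \<omega>)) \<le> G * (a * S)"
      using nonneg a by (intro expectation_inner_le bounded_rv_intros bdd EX EWZ) auto
    then have 2: "a * expectation (\<lambda>\<omega>. X \<omega> \<bullet> (W \<omega> - Z \<omega>)) \<le> a * (G * (a * S))"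
      using a by (intro mult_left_mono)
    have "expectation (\<lambda>\<omega>. (norm (c *\<^sub>R V \<omega>))\<^sup>2) \<le> (\<bar>c\<bar> * U)\<^sup>2"
      using EV by (simp add: power_mult_distrib mult_left_mono)
    then have "expectation (\<lambda>\<omega>. (c *\<^sub>R V \<omega>) \<bullet> (Z \<omega> - v)) \<le> (\<bar>c\<bar> * U) * B"
      using nonneg by (intro expectation_inner_le bounded_rv_intros bdd EZ) auto
    also have "\<dots> \<le> a\<^sup>2 * U * B"
      using c nonneg by (intro mult_right_mono) auto
    finally have 3: "expectation (\<lambda>\<omega>. (c *\<^sub>R V \<omega>) \<bullet> (Z \<omega> - v)) \<le> a\<^sup>2 * U * B" .
    have 4: "a\<^sup>2 * expectation (\<lambda>\<omega>. (norm (X \<omega>))\<^sup>2) \<le> a\<^sup>2 * G\<^sup>2"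
      using EX by (intro mult_left_mono) auto
    \<comment> \<open>Here \<open>a \<le> 1\<close> enters: the drift coefficient satisfies
      \<open>\<bar>c\<bar> \<le> a\<^sup>2 \<le> a\<close>, so its square stays within order
      \<open>a\<^sup>2\<close>.\<close>
    have "a\<^sup>2 \<le> a" using a by (simp add: power2_eq_square mult_left_le)
    then have "c\<^sup>2 \<le> a\<^sup>2"
      using c a by (simp add: abs_le_square_iff[symmetric])
    then have 5: "c\<^sup>2 * expectation (\<lambda>\<omega>. (norm (V \<omega>))\<^sup>2) \<le> a\<^sup>2 * U\<^sup>2"
      using EV by (intro mult_mono) auto
    show ?thesis using 1 2 3 4 5 by linarith
  qed
  also have "\<dots> = expectation (\<lambda>\<omega>. (norm (Z \<omega> - v))\<^sup>2)
    - 2 * a * \<delta> + a\<^sup>2 * (2 * G * S + 2 * U * B + 2 * G\<^sup>2 + 2 * U\<^sup>2)"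
    by (simp add: algebra_simps power2_eq_square)
  finally show ?thesis .
qed

subsection \<open>Step sizes and rate\<close>

text \<open>After clearing denominators the upper bound reads
  \<open>(q - 1) * r \<le> q\<^sup>2\<close>, which follows from \<open>r \<le> q + 1\<close>. The
  true order is \<open>s\<close> to the power -3/2; the cruder \<open>1 / s\<close> equals the
  squared step at \<open>s = t + 1\<close>.\<close>

lemma inverse_sqrt_diff_bounds:
  fixes s :: real
  assumes "s \<ge> 1"
  shows "0 \<le> 1 / sqrt s - 1 / sqrt (s + 1)" and "1 / sqrt s - 1 / sqrt (s + 1) \<le> 1 / s"
proof -
  define q r where "q = sqrt s" and "r = sqrt (s + 1)"
  have q: "q \<ge> 1" "s = q\<^sup>2" and r: "r \<ge> q" "r\<^sup>2 = q\<^sup>2 + 1" "r \<ge> 0"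
    using assms by (auto simp: q_def r_def)
  have "r \<le> q + 1"
    using q r by (intro power2_le_imp_le[of r "q + 1"]) (auto simp: power2_sum)
  then have "(q - 1) * r \<le> (q - 1) * (q + 1)" using q by (intro mult_left_mono) auto
  then have "(q - 1) * r \<le> q * q" by (simp add: algebra_simps)
  then have "q * ((q - 1) * r) \<le> q * (q * q)" using q by (intro mult_left_mono) auto
  then have "1 / q - 1 / r \<le> 1 / q\<^sup>2"
    using q(1) r(1) by (simp add: field_simps power2_eq_square)
  then show "1 / sqrt s - 1 / sqrt (s + 1) \<le> 1 / s" using assms by (simp add: q_def r_def)
  show "0 \<le> 1 / sqrt s - 1 / sqrt (s + 1)"
    using assms by (simp add: frac_le)
qed

text \<open>The \<open>T\<close> weights are each at least \<open>1 / sqrt T\<close>, so their sum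
  is at least \<open>sqrt T\<close>, while the harmonic sum in the bound is at most
  \<open>1 + ln T\<close>. From \<open>T = 3\<close> on, \<open>ln T \<ge> 1\<close> absorbs the
  additive constants, which gives \<open>D + 2 * C\<close>.\<close>

lemma average_rate_bigo:
  fixes e :: "nat \<Rightarrow> real"
  assumes e: "\<And>t. e t \<ge> 0" and "C \<ge> 0" "D \<ge> 0"
    and bound: "\<And>T. (\<Sum>t<T. 2 / sqrt (real t + 1) * e t) \<le> D + (\<Sum>t<T. C / (real t + 1))"
  shows "(\<lambda>T. (\<Sum>t<T. 1 / sqrt (real t + 1) * e t) / (\<Sum>t<T. 1 / sqrt (real t + 1)))
      \<in> O(\<lambda>T. ln (real T) / sqrt (real T))"
proof (rule bigoI[where c = "D + 2 * C"])
  have "norm ((\<Sum>t<T. 1 / sqrt (real t + 1) * e t) / (\<Sum>t<T. 1 / sqrt (real t + 1)))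
      \<le> (D + 2 * C) * norm (ln (real T) / sqrt (real T))" if T: "T \<ge> 3" for T
  proof -
    define N where "N = (\<Sum>t<T. 1 / sqrt (real t + 1) * e t)"
    define A where "A = (\<Sum>t<T. 1 / sqrt (real t + 1))"
    have "exp 1 \<le> real T" using exp_le T by linarith
    then have ln: "ln (real T) \<ge> 1" using T by (simp add: ln_ge_iff)
    have "(\<Sum>t<T. 1 / sqrt (real T)) \<le> A"
      unfolding A_def by (intro sum_mono) (auto intro!: divide_left_mono)
    then have A: "sqrt (real T) \<le> A"
      using real_div_sqrt[of "real T"] by simp
    have A_pos: "A > 0" by (rule less_le_trans[OF _ A]) (use T in simp)
    \<comment> \<open>The sequence \<open>harm n - ln n\<close> decreases from its value 1 at
      \<open>n = 1\<close>; the library indexes it by \<open>Suc\<close>, hence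
      \<open>T - 1\<close>.\<close>
    have "harm (Suc (T - 1)) - ln (real (Suc (T - 1))) \<le> harm (Suc 0) - ln (real (Suc 0))"
      using decseq_harm_diff_ln by (rule decseqD) simp
    then have "harm T \<le> 1 + ln (real T)" using T by (simp add: harm_def)
    moreover have "harm T = (\<Sum>t<T. 1 / (real t + 1))"
      unfolding harm_def
      by (rule sum.reindex_bij_witness[of _ Suc "\<lambda>k. k - 1"]) (auto simp: field_simps)
    ultimately have H: "(\<Sum>t<T. 1 / (real t + 1)) \<le> 1 + ln (real T)" by simp
    have "2 * N \<le> D + C * (\<Sum>t<T. 1 / (real t + 1))"
      using bound[of T] by (simp add: N_def sum_distrib_left)
    also have "\<dots> \<le> D + C * (1 + ln (real T))"
      using H \<open>C \<ge> 0\<close> by (simp add: mult_left_mono)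
    also have "\<dots> \<le> D * ln (real T) + C * (2 * ln (real T))"
      using ln \<open>C \<ge> 0\<close> \<open>D \<ge> 0\<close>
      by (intro add_mono mult_left_mono) (auto simp: mult_le_cancel_left1)
    also have "\<dots> = (D + 2 * C) * ln (real T)" by (simp add: algebra_simps)
    finally have N2: "2 * N \<le> (D + 2 * C) * ln (real T)" .
    have N: "N \<ge> 0" unfolding N_def by (intro sum_nonneg) (simp add: e)
    have "norm (N / A) = N / A"
      using N A_pos by simp
    also have "\<dots> \<le> N / sqrt (real T)"
      using N A A_pos T by (intro divide_left_mono) auto
    \<comment> \<open>A factor 2 is given away here, since \<open>N \<le> 2 * N\<close>.\<close>
    also have "\<dots> \<le> (D + 2 * C) * ln (real T) / sqrt (real T)"
      using N N2 by (intro divide_right_mono) auto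
    also have "\<dots> = (D + 2 * C) * norm (ln (real T) / sqrt (real T))"
      using ln by simp
    finally show ?thesis by (simp add: N_def A_def)
  qed
  then show "\<forall>\<^sub>F T in sequentially.
      norm ((\<Sum>t<T. 1 / sqrt (real t + 1) * e t) / (\<Sum>t<T. 1 / sqrt (real t + 1)))
      \<le> (D + 2 * C) * norm (ln (real T) / sqrt (real T))"
    by (rule eventually_sequentiallyI)
qed

theorem theorem9:
  fixes M :: "'s measure"
    and f :: "real ^ 'd \<Rightarrow> 'z \<Rightarrow> real" and \<zeta> :: "nat \<Rightarrow> 'z"
    and n p b :: nat
    and \<beta> G U B C :: real
    and \<eta> :: "nat \<Rightarrow> real" and \<rho> :: "int \<Rightarrow> real"
    and I :: "nat \<Rightarrow> nat \<Rightarrow> 's \<Rightarrow> nat multiset"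
    and m u :: "nat \<Rightarrow> nat \<Rightarrow> 's \<Rightarrow> real ^ 'd"
    and g :: "int \<Rightarrow> nat \<Rightarrow> 's \<Rightarrow> real ^ 'd"
    and w z u_sum :: "nat \<Rightarrow> 's \<Rightarrow> real ^ 'd"
    and g_sum :: "int \<Rightarrow> 's \<Rightarrow> real ^ 'd"
    and w0 wstar :: "real ^ 'd"
    and F :: "real ^ 'd \<Rightarrow> real"
  assumes "prob_space M"
    and "n \<ge> 1" and "p \<ge> 1" and "b \<ge> 1"
    and "0 \<le> \<beta>" and "\<beta> < 1" and "G > 0" and "U \<ge> 0" and "B \<ge> 0"
    and F: "F = objective f \<zeta> n"
    and differentiable: "\<And>i v. i \<in> {1..n} \<Longrightarrow> (\<lambda>v'. f v' (\<zeta> i)) differentiable (at v)"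
    and minimizer: "\<And>v. F wstar \<le> F v"
    and sample_gradient_bound:
      "\<And>v. (1 / real n) * (\<Sum>i=1..n. (norm (sample_gradient f \<zeta> i v))\<^sup>2) \<le> G\<^sup>2"
    and algorithm: "M_DSGD M f \<zeta> n p b \<beta> \<eta> w0 I m g u w"
    and u_sum: "\<And>t \<omega>. u_sum t \<omega> = (\<Sum>k=1..p. u t k \<omega>)"
    and g_sum: "\<And>t \<omega>. g_sum t \<omega> = (\<Sum>k=1..p. g t k \<omega>)"
    and z: "\<And>t \<omega>. z t \<omega> = w t \<omega> + \<rho> (int t - 1) *\<^sub>R g_sum (int t - 1) \<omega> - \<eta> t *\<^sub>R u_sum t \<omega>"
    and \<rho>_recurrence: "\<And>t::nat. \<beta> * \<rho> (int t) = \<beta> * \<eta> t + \<rho> (int t - 1)"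
    and convex: "gradient_convex F"
    and stochastic_gradient:
      "\<And>t. bounded_stochastic_gradient M F G (w t)
             (\<lambda>\<omega>. minibatch_gradient f \<zeta> p b (\<lambda>k. I t k \<omega>) (w t \<omega>))"
    and u_bound: "\<And>t. prob_space.expectation M (\<lambda>\<omega>. (norm (u_sum t \<omega>))\<^sup>2) \<le> U\<^sup>2"
    and z_bound: "\<And>t. prob_space.expectation M (\<lambda>\<omega>. (norm (z t \<omega> - wstar))\<^sup>2) \<le> B\<^sup>2"
    and \<rho>: "\<And>t. t \<ge> -1 \<Longrightarrow> \<rho> t = - \<beta> / sqrt (real_of_int t + 2)"
    and \<eta>: "\<And>t. \<eta> t = 1 / sqrt (real t + 1) * (1 - \<beta> * sqrt (real t + 1) / sqrt (real t + 2))"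
    and C: "C = 2 * G * sqrt (2 * G\<^sup>2 * \<beta>\<^sup>2 / (1 - \<beta>)\<^sup>2 + 2 * U\<^sup>2)
                + 2 * U * B + 2 * G\<^sup>2 + 2 * U\<^sup>2"
  shows "(\<forall>T. (\<Sum>t<T. 2 / sqrt (real t + 1) * prob_space.expectation M (\<lambda>\<omega>. F (w t \<omega>) - F wstar))
              \<le> (norm (w0 - wstar))\<^sup>2 + (\<Sum>t<T. C / (real t + 1))) \<and>
         (\<lambda>T. (\<Sum>t<T. 1 / sqrt (real t + 1) * prob_space.expectation M (\<lambda>\<omega>. F (w t \<omega>) - F wstar))
              / (\<Sum>t<T. 1 / sqrt (real t + 1)))
           \<in> O(\<lambda>T. ln (real T) / sqrt (real T))"
proof -
  interpret prob_space M by fact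
  define X where "X t \<omega> = minibatch_gradient f \<zeta> p b (\<lambda>k. I t k \<omega>) (w t \<omega>)" for t \<omega>
  define a where "a t = 1 / sqrt (real t + 1)" for t
  define S where "S = sqrt (2 * G\<^sup>2 * \<beta>\<^sup>2 / (1 - \<beta>)\<^sup>2 + 2 * U\<^sup>2)"
  define \<delta> where "\<delta> t = expectation (\<lambda>\<omega>. F (w t \<omega>) - F wstar)" for t
  note beta = \<open>0 \<le> \<beta>\<close> \<open>\<beta> < 1\<close>
  note nonneg = less_imp_le[OF \<open>G > 0\<close>] \<open>U \<ge> 0\<close> \<open>B \<ge> 0\<close>

  \<comment> \<open>Boundedness of the iterates and of the objective along them\<close>
  have sg_meas: "sample_gradient f \<zeta> i \<in> borel_measurable borel" if "i \<in> {1..n}" for i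
    using borel_measurable_gradient[OF differentiable[OF that]]
    unfolding sample_gradient_def[abs_def] .
  \<comment> \<open>The mean of \<open>n\<close> nonnegative squares is at most
    \<open>G\<^sup>2\<close>, so each single square is at most \<open>n * G\<^sup>2\<close>.\<close>
  have sg_le: "norm (sample_gradient f \<zeta> i v) \<le> sqrt (real n) * G" if "i \<in> {1..n}" for i v
  proof -
    have "(norm (sample_gradient f \<zeta> i v))\<^sup>2 \<le> (\<Sum>i=1..n. (norm (sample_gradient f \<zeta> i v))\<^sup>2)"
      using that by (intro member_le_sum) auto
    also have "\<dots> \<le> real n * G\<^sup>2"
      using sample_gradient_bound[of v] \<open>n \<ge> 1\<close> by (simp add: field_simps)
    also have "\<dots> = (sqrt (real n) * G)\<^sup>2" by (simp add: power_mult_distrib)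
    finally show ?thesis by (rule power2_le_imp_le) (use nonneg in simp)
  qed
  note bdd = M_DSGD_bounded_rv[OF algorithm sg_meas sg_le]
  have w_bdd: "bounded_rv M (w t)" for t
    using bdd(1) by blast
  have u_bdd: "bounded_rv M (u_sum t)" for t
    unfolding u_sum[abs_def] by (intro bounded_rv_sum bdd(3)) auto
  have g_bdd: "bounded_rv M (g_sum (int t - 1))" for t
    unfolding g_sum[abs_def] by (intro bounded_rv_sum bdd(2)) auto
  have X_bdd: "bounded_rv M (X t)" for t
    unfolding X_def[abs_def] minibatch_gradient_def
    by (intro bounded_rv_scaleR bounded_rv_const bounded_rv_sum bdd(4)) auto
  have z_bdd: "bounded_rv M (z t)" for t
    unfolding z[abs_def] by (intro bounded_rv_intros w_bdd u_bdd g_bdd)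

  have "continuous_on UNIV (\<lambda>v. f v (\<zeta> i))" if "i \<in> {1..n}" for i
    using differentiable[OF that]
    by (simp add: continuous_at_imp_continuous_on differentiable_imp_continuous_within)
  then have "continuous_on UNIV F"
    unfolding F objective_def[abs_def] by (intro continuous_intros) auto
  then have F_bdd: "bounded_rv M (\<lambda>\<omega>. F (w t \<omega>))" for t
    using w_bdd by (rule bounded_rv_continuous)

  \<comment> \<open>The step sizes expressed through \<open>a\<close>\<close>
  have a: "0 \<le> a t" "a t \<le> 1" "(a t)\<^sup>2 = 1 / (real t + 1)" "a (Suc t) \<le> a t" for t
    by (auto simp: a_def power_divide intro!: frac_le)
  have \<eta>_a: "\<eta> t = a t - \<beta> * a (Suc t)" for t
    unfolding \<eta> a_def by (simp add: field_simps add.commute[of 2])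
  have \<rho>_a: "\<rho> (int t - 1) = - (\<beta> * a t)" for t
    using \<rho>[of "int t - 1"] by (simp add: a_def)
  \<comment> \<open>The difference is \<open>a t - a (Suc t)\<close> minus \<beta> times the next
    such decrement. Both numbers lie between 0 and \<open>1 / (t + 1)\<close>, so their difference
    does not exceed this in absolute value.\<close>
  have \<eta>_diff: "\<bar>\<eta> t - \<eta> (Suc t)\<bar> \<le> (a t)\<^sup>2" for t
  proof -
    have d: "0 \<le> a s - a (Suc s)" "a s - a (Suc s) \<le> 1 / (real s + 1)" for s
      using inverse_sqrt_diff_bounds[of "real s + 1"] by (simp_all add: a_def add.commute add.left_commute)
    have "1 / (real (Suc t) + 1) \<le> 1 / (real t + 1)" by (intro divide_left_mono) auto
    then have "\<beta> * (a (Suc t) - a (Suc (Suc t))) \<le> 1 * (1 / (real t + 1))"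
      using beta d[of "Suc t"] by (intro mult_mono) auto
    moreover have "0 \<le> \<beta> * (a (Suc t) - a (Suc (Suc t)))"
      using beta d[of "Suc t"] by (intro mult_nonneg_nonneg) auto
    ultimately show ?thesis
      using d[of t] by (simp add: \<eta>_a a(3) algebra_simps abs_le_iff)
  qed

  \<comment> \<open>Recursions for the momentum and the auxiliary sequence\<close>
  have g_step: "g_sum (int t) \<omega> = \<beta> *\<^sub>R g_sum (int t - 1) \<omega> + X t \<omega>" if "\<omega> \<in> space M" for t \<omega>
    using M_DSGD_sum_g[OF algorithm that] by (simp add: g_sum X_def)
  have init: "w 0 \<omega> = w0" "g_sum (- 1) \<omega> = 0" "u_sum 0 \<omega> = 0" if "\<omega> \<in> space M" for \<omega>
    using algorithm that unfolding M_DSGD_def by (auto simp: g_sum u_sum intro!: sum.neutral)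
  \<comment> \<open>In \<open>z (Suc t)\<close> the coefficient of \<open>g_sum t\<close> is
    \<open>\<rho> t - \<eta> t = - a t\<close>. Substituting \<open>g_step\<close> turns this into
    \<open>- a t\<close> times \<open>X t\<close> plus
    \<open>- \<beta> * a t = \<rho> (t - 1)\<close> times the old momentum, which is the momentum
    term already present in \<open>z t\<close>.\<close>
  have z_step: "z (Suc t) \<omega> = z t \<omega> - a t *\<^sub>R X t \<omega> + (\<eta> t - \<eta> (Suc t)) *\<^sub>R u_sum (Suc t) \<omega>"
    if "\<omega> \<in> space M" for t \<omega>
  proof -
    have "\<rho> (int t) = - (\<beta> * a (Suc t))" using \<rho>_a[of "Suc t"] by simp
    moreover have "w (Suc t) \<omega> = w t \<omega> - \<eta> t *\<^sub>R (g_sum (int t) \<omega> + u_sum t \<omega> - u_sum (Suc t) \<omega>)"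
      using M_DSGD_w_step[OF algorithm that] by (simp add: g_sum u_sum)
    ultimately show ?thesis
      by (simp add: z g_step[OF that] \<rho>_a \<eta>_a algebra_simps)
  qed

  \<comment> \<open>Second-moment bounds\<close>
  have EX: "expectation (\<lambda>\<omega>. (norm (X t \<omega>))\<^sup>2) \<le> G\<^sup>2" for t
    using stochastic_gradient[of t] by (simp add: bounded_stochastic_gradient_def X_def)
  have Eg: "expectation (\<lambda>\<omega>. (norm (g_sum (int t - 1) \<omega>))\<^sup>2) \<le> (G / (1 - \<beta>))\<^sup>2" for t
    by (rule expectation_momentum_le[OF beta nonneg(1), where X = X])
       (auto intro: g_bdd X_bdd EX simp: init g_step)
  have S: "S \<ge> 0" "S\<^sup>2 = 2 * G\<^sup>2 * \<beta>\<^sup>2 / (1 - \<beta>)\<^sup>2 + 2 * U\<^sup>2"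
    by (auto simp: S_def)
  \<comment> \<open>The displacement is \<open>\<beta> * a t\<close> times the momentum plus
    \<open>\<eta> t\<close> times the memory. As \<open>\<beta> * a (Suc t)\<close> lies between 0
    and \<open>a t\<close>, also \<open>\<bar>\<eta> t\<bar> \<le> a t\<close>, so a factor
    \<open>a t\<close> comes out and \<open>S\<close> is what remains.\<close>
  have Ewz: "expectation (\<lambda>\<omega>. (norm (w t \<omega> - z t \<omega>))\<^sup>2) \<le> (a t * S)\<^sup>2" for t
  proof -
    have "0 \<le> \<beta> * a (Suc t)" "\<beta> * a (Suc t) \<le> 1 * a t"
      using beta a(1)[of t] a(1)[of "Suc t"] a(4)[of t] mult_mono[of \<beta> 1 "a (Suc t)" "a t"] by auto
    then have "\<bar>\<eta> t\<bar> \<le> \<bar>a t\<bar>" by (simp add: \<eta>_a)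
    then have \<eta>2: "(\<eta> t)\<^sup>2 \<le> (a t)\<^sup>2" by (simp add: abs_le_square_iff)
    have int: "integrable M (\<lambda>\<omega>. (norm (w t \<omega> - z t \<omega>))\<^sup>2)"
        "integrable M (\<lambda>\<omega>. (norm (g_sum (int t - 1) \<omega>))\<^sup>2)"
        "integrable M (\<lambda>\<omega>. (norm (u_sum t \<omega>))\<^sup>2)"
      by (intro integrable_bounded_rv bounded_rv_intros w_bdd z_bdd g_bdd u_bdd)+
    have "(norm (w t \<omega> - z t \<omega>))\<^sup>2 \<le> 2 * (\<beta> * a t)\<^sup>2 * (norm (g_sum (int t - 1) \<omega>))\<^sup>2
        + 2 * (\<eta> t)\<^sup>2 * (norm (u_sum t \<omega>))\<^sup>2" for \<omega>
      using norm_add_power2_le[of "(\<beta> * a t) *\<^sub>R g_sum (int t - 1) \<omega>" "\<eta> t *\<^sub>R u_sum t \<omega>"]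
      by (simp add: z \<rho>_a power_mult_distrib)
    then have "expectation (\<lambda>\<omega>. (norm (w t \<omega> - z t \<omega>))\<^sup>2)
        \<le> expectation (\<lambda>\<omega>. 2 * (\<beta> * a t)\<^sup>2 * (norm (g_sum (int t - 1) \<omega>))\<^sup>2
          + 2 * (\<eta> t)\<^sup>2 * (norm (u_sum t \<omega>))\<^sup>2)"
      using int by (intro integral_mono) auto
    also have "\<dots> = 2 * (\<beta> * a t)\<^sup>2 * expectation (\<lambda>\<omega>. (norm (g_sum (int t - 1) \<omega>))\<^sup>2)
          + 2 * (\<eta> t)\<^sup>2 * expectation (\<lambda>\<omega>. (norm (u_sum t \<omega>))\<^sup>2)"
      using int by simp
    also have "\<dots> \<le> 2 * (\<beta> * a t)\<^sup>2 * (G / (1 - \<beta>))\<^sup>2 + 2 * (a t)\<^sup>2 * U\<^sup>2"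
      using Eg[of t] u_bound[of t] \<eta>2 by (intro add_mono mult_mono) auto
    also have "\<dots> = (a t * S)\<^sup>2"
      by (simp add: power_mult_distrib S(2) power_divide algebra_simps)
    finally show ?thesis .
  qed

  \<comment> \<open>Descent inequality and summation\<close>
  have descent: "expectation (\<lambda>\<omega>. (norm (z (Suc t) \<omega> - wstar))\<^sup>2)
      \<le> expectation (\<lambda>\<omega>. (norm (z t \<omega> - wstar))\<^sup>2) - 2 * a t * \<delta> t + C / (real t + 1)" for t
  proof -
    have "\<delta> t \<le> expectation (\<lambda>\<omega>. X t \<omega> \<bullet> (w t \<omega> - wstar))"
      unfolding \<delta>_def using stochastic_gradient[of t]
      by (intro expectation_suboptimality_le[OF X_bdd w_bdd F_bdd convex]) (simp add: X_def[abs_def])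
    then have "expectation (\<lambda>\<omega>. (norm (z (Suc t) \<omega> - wstar))\<^sup>2)
      \<le> expectation (\<lambda>\<omega>. (norm (z t \<omega> - wstar))\<^sup>2) - 2 * a t * \<delta> t
        + (a t)\<^sup>2 * (2 * G * S + 2 * U * B + 2 * G\<^sup>2 + 2 * U\<^sup>2)"
      using expectation_descent_step[OF z_bdd w_bdd X_bdd u_bdd z_step a(1,2) \<eta>_diff
          nonneg S(1) EX u_bound z_bound Ewz] by blast
    then show ?thesis by (simp add: a(3) C S_def)
  qed
  \<comment> \<open>The final distance is kept on the left to carry the induction; being
    nonnegative, it is dropped in \<open>bound\<close>.\<close>
  have telescope: "(\<Sum>t<T. 2 * a t * \<delta> t) + expectation (\<lambda>\<omega>. (norm (z T \<omega> - wstar))\<^sup>2)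
      \<le> (norm (w0 - wstar))\<^sup>2 + (\<Sum>t<T. C / (real t + 1))" for T
  proof (induction T)
    case 0
    \<comment> \<open>The momentum at -1 and the memory at 0 both vanish.\<close>
    have "z 0 \<omega> = w0" if "\<omega> \<in> space M" for \<omega>
      using init[OF that] by (simp add: z)
    then have "expectation (\<lambda>\<omega>. (norm (z 0 \<omega> - wstar))\<^sup>2) = expectation (\<lambda>\<omega>. (norm (w0 - wstar))\<^sup>2)"
      by (intro Bochner_Integration.integral_cong) auto
    then show ?case by (simp add: prob_space)
  next
    case (Suc T)
    then show ?case using descent[of T] by simp
  qed
  have bound: "(\<Sum>t<T. 2 / sqrt (real t + 1) * \<delta> t)
      \<le> (norm (w0 - wstar))\<^sup>2 + (\<Sum>t<T. C / (real t + 1))" for T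
    by (rule order_trans[OF _ telescope[of T]]) (simp add: a_def)
  \<comment> \<open>Minimality of \<open>wstar\<close> makes the gaps nonnegative, as
    \<open>average_rate_bigo\<close> requires.\<close>
  moreover have "\<delta> t \<ge> 0" for t
    unfolding \<delta>_def using minimizer by (intro Bochner_Integration.integral_nonneg) auto
  moreover have "C \<ge> 0"
    unfolding C S_def[symmetric] using nonneg S(1) by simp
  ultimately show ?thesis
    using average_rate_bigo[of \<delta> C "(norm (w0 - wstar))\<^sup>2"] by (simp add: \<delta>_def)
qed

end
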